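(* There is an absolute constant $C$ such that the following holds. Let $T$ be a finite set of primes, and let either $Y=U_T$ and $H=H(T)$, or $Y=W_T$ and $H=H'(T)$. Let $Z\sim\mathrm{Pois}(H)$. Then for every integer $k\ge 0$, \[ |\mathbb P(Y=k)-\mathbb P(Z=k)|\le\begin{cases} C\,H''(T)\,\dfrac{H^k}{k!}\mathrm{e}^{-H}\Big(\dfrac1{k+1}+\Big(\dfrac{k-H}{H}\Big)^2\Big) & \text{if } 0\le k\le 1.9H,\\[2mm] C\,H''(T)\,\dfrac{\mathrm{e}^{0.9H}}{(1.9)^k} & \text{if } k>1.9H.\end{cases} \]
   Context: Kubilius model: for each prime $p$, $X_p$ is a random variable on $\{0,1,2,\ldots\}$ with $\mathbb P(X_p=k)=p^{-k}(1-1/p)$, and the $X_p$ are mutually independent. For a finite set $T$ of primes, $U_T=\#\{p\in T:X_p\ge1\}$ and $W_T=\sum_{p\in T}X_p$. $H(T)=\sum_{p\in T}1/p$, $H'(T)=\sum_{p\in T}1/(p-1)$, $H''(T)=\sum_{p\in T}1/p^2$. $\mathrm{Pois}(\lambda)$ is a Poisson random variable with parameter $\lambda$. *)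

theory Defs
  imports "HOL-Probability.Probability"
begin

text \<open>Kubilius model: joint law of the independent family (X_p)_{p in T},
  with P(X_p = k) = p^(-k) (1 - 1/p), i.e. geometric with success probability 1 - 1/p.\<close>
definition kubilius :: "nat set \<Rightarrow> (nat \<Rightarrow> nat) pmf" where
  "kubilius T = Pi_pmf T 0 (\<lambda>p. geometric_pmf (1 - 1 / real p))"

definition U_law :: "nat set \<Rightarrow> nat pmf" where
  "U_law T = map_pmf (\<lambda>X. card {p \<in> T. X p \<ge> 1}) (kubilius T)"

definition W_law :: "nat set \<Rightarrow> nat pmf" where
  "W_law T = map_pmf (\<lambda>X. \<Sum>p\<in>T. X p) (kubilius T)"

definition H :: "nat set \<Rightarrow> real" where "H T = (\<Sum>p\<in>T. 1 / real p)"
definition H' :: "nat set \<Rightarrow> real" where "H' T = (\<Sum>p\<in>T. 1 / (real p - 1))"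
definition H'' :: "nat set \<Rightarrow> real" where "H'' T = (\<Sum>p\<in>T. 1 / (real p)^2)"

text \<open>P(Pois(lambda) = k), written explicitly so that lambda = 0 (T empty) is allowed.\<close>
definition pois_prob :: "real \<Rightarrow> nat \<Rightarrow> real" where
  "pois_prob lam k = lam ^ k / fact k * exp (- lam)"

definition kub_bound :: "real \<Rightarrow> real \<Rightarrow> real \<Rightarrow> nat \<Rightarrow> real" where
  "kub_bound C Hv H2 k =
     (if real k \<le> 1.9 * Hv
      then C * H2 * (Hv ^ k / fact k) * exp (- Hv) * (1 / (real k + 1) + ((real k - Hv) / Hv)^2)
      else C * H2 * exp (0.9 * Hv) / 1.9 ^ k)"

end

theory Submission
  imports Defs "HOL-Real_Asymp.Real_Asymp"
begin

text \<open>
  Write the probability generating function of \<open>Y\<close> as \<open>G(z) exp (H (z - 1))\<close>. Each prime contributes to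
  \<open>G\<close> a factor that agrees with 1 to second order at \<open>z = 1\<close>, so \<open>G(z) = 1 + (1 - z)\<^sup>2 h(z)\<close>, where the
  weighted coefficient norm \<open>\<Sum> |h\<^sub>j| 1.95\<^sup>j\<close> is \<open>O(H''(T))\<close>; this uses only that the norm is
  submultiplicative and that \<open>\<Sum> 1/p\<^sup>2\<close> is bounded. The error at \<open>k\<close> is then \<open>\<Sum>\<^sub>j h\<^sub>j \<Delta>\<^sup>2\<pi>(k - j)\<close>,
  \<open>\<pi>\<close> being the Poisson weights. For \<open>k \<le> 1.9 H\<close> one uses the explicit formula for \<open>\<Delta>\<^sup>2\<pi>\<close> and
  \<open>\<pi>(k - j) \<le> 1.9\<^sup>j \<pi>(k)\<close>; the surplus of 1.95 over 1.9 absorbs polynomial factors in \<open>j\<close>. For larger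
  \<open>k\<close> the norm with weight 1.9 suffices.
\<close>

section \<open>A weighted coefficient norm on power series\<close>

text \<open>\<open>M\<close> is only an upper bound for the weighted l1 norm. Bounding every partial
  sum builds summability in for \<open>r \<ge> 0\<close>, so no convergence side conditions
  arise.\<close>

definition wnorm_le :: "real \<Rightarrow> real fps \<Rightarrow> real \<Rightarrow> bool" where
  "wnorm_le r f M \<longleftrightarrow> (\<forall>n. (\<Sum>i<n. \<bar>fps_nth f i\<bar> * r ^ i) \<le> M)"

lemma wnorm_leD: "wnorm_le r f M \<Longrightarrow> (\<Sum>i<n. \<bar>fps_nth f i\<bar> * r ^ i) \<le> M"
  by (simp add: wnorm_le_def)

lemma wnorm_le_nonneg: "wnorm_le r f M \<Longrightarrow> 0 \<le> M"
  using wnorm_leD[of r f M 0] by simp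

lemma wnorm_le_mono: "wnorm_le r f M \<Longrightarrow> M \<le> N \<Longrightarrow> wnorm_le r f N"
  by (meson wnorm_le_def order_trans)

lemma wnorm_le_weight_mono:
  assumes "wnorm_le r f M" "0 \<le> s" "s \<le> r"
  shows "wnorm_le s f M"
  unfolding wnorm_le_def
proof
  fix n
  have "(\<Sum>i<n. \<bar>fps_nth f i\<bar> * s ^ i) \<le> (\<Sum>i<n. \<bar>fps_nth f i\<bar> * r ^ i)"
    using assms by (intro sum_mono mult_left_mono power_mono) auto
  then show "(\<Sum>i<n. \<bar>fps_nth f i\<bar> * s ^ i) \<le> M"
    using wnorm_leD[OF assms(1), of n] by linarith
qed

lemma wnorm_le_nth:
  assumes "wnorm_le r f M" "0 \<le> r"
  shows "\<bar>fps_nth f n\<bar> * r ^ n \<le> M"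
proof -
  have "\<bar>fps_nth f n\<bar> * r ^ n \<le> (\<Sum>i<Suc n. \<bar>fps_nth f i\<bar> * r ^ i)"
    using assms(2) by (simp add: sum_nonneg)
  then show ?thesis using wnorm_leD[OF assms(1), of "Suc n"] by linarith
qed

lemma wnorm_le_sums:
  assumes "\<And>n. \<bar>fps_nth f n\<bar> * r ^ n \<le> g n" "g sums M" "0 \<le> r"
  shows "wnorm_le r f M"
  unfolding wnorm_le_def
proof
  fix n
  have g0: "0 \<le> g i" for i
    using assms(1)[of i] assms(3) by (meson abs_ge_zero mult_nonneg_nonneg order_trans zero_le_power)
  have "(\<Sum>i<n. \<bar>fps_nth f i\<bar> * r ^ i) \<le> (\<Sum>i<n. g i)"
    by (intro sum_mono assms(1))
  also have "\<dots> \<le> suminf g"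
    using assms(2) g0 by (intro sum_le_suminf) (auto simp: sums_iff)
  finally show "(\<Sum>i<n. \<bar>fps_nth f i\<bar> * r ^ i) \<le> M"
    using assms(2) by (simp add: sums_iff)
qed

lemma wnorm_le_const: "wnorm_le r (fps_const c) \<bar>c\<bar>"
  unfolding wnorm_le_def
proof
  fix n
  show "(\<Sum>i<n. \<bar>fps_nth (fps_const c) i\<bar> * r ^ i) \<le> \<bar>c\<bar>"
    by (cases n) (simp_all del: sum.lessThan_Suc add: sum.lessThan_Suc_shift)
qed

lemma wnorm_le_1: "wnorm_le r 1 1"
  using wnorm_le_const[of r 1] by simp

lemma wnorm_le_X:
  assumes "0 \<le> r"
  shows "wnorm_le r fps_X r"
proof (rule wnorm_le_sums[where g = "\<lambda>n. if n = 1 then r else 0"])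
  show "(\<lambda>n. if n = 1 then r else 0) sums r"
    using sums_single[of 1 "\<lambda>_. r"] by simp
qed (use assms in \<open>auto simp: fps_X_def\<close>)

lemma wnorm_le_uminus: "wnorm_le r f M \<Longrightarrow> wnorm_le r (- f) M"
  by (simp add: wnorm_le_def)

lemma wnorm_le_add:
  assumes "wnorm_le r f M" "wnorm_le r g N" "0 \<le> r"
  shows "wnorm_le r (f + g) (M + N)"
  unfolding wnorm_le_def
proof
  fix n
  have "(\<Sum>i<n. \<bar>fps_nth (f + g) i\<bar> * r ^ i)
      \<le> (\<Sum>i<n. \<bar>fps_nth f i\<bar> * r ^ i + \<bar>fps_nth g i\<bar> * r ^ i)"
    using assms(3) by (intro sum_mono) (simp flip: distrib_right add: mult_right_mono abs_triangle_ineq)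
  then show "(\<Sum>i<n. \<bar>fps_nth (f + g) i\<bar> * r ^ i) \<le> M + N"
    using wnorm_leD[OF assms(1), of n] wnorm_leD[OF assms(2), of n] by (simp add: sum.distrib)
qed

lemma wnorm_le_diff:
  assumes "wnorm_le r f M" "wnorm_le r g N" "0 \<le> r"
  shows "wnorm_le r (f - g) (M + N)"
  using wnorm_le_add[OF assms(1) wnorm_le_uminus[OF assms(2)] assms(3)] by simp

text \<open>The partial sums of the Cauchy product run over the triangle \<open>i + j < n\<close>.
  It lies in the square \<open>i, j < n\<close>, where the double sum of nonnegative terms
  factors.\<close>

lemma wnorm_le_mult:
  assumes "wnorm_le r f M" "wnorm_le r g N" "0 \<le> r"
  shows "wnorm_le r (f * g) (M * N)"
  unfolding wnorm_le_def
proof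
  fix n
  define F where "F i = \<bar>fps_nth f i\<bar> * r ^ i" for i
  define G where "G i = \<bar>fps_nth g i\<bar> * r ^ i" for i
  have F0: "0 \<le> F i" and G0: "0 \<le> G i" for i
    using assms(3) by (simp_all add: F_def G_def)
  have "\<bar>fps_nth (f * g) k\<bar> * r ^ k \<le> (\<Sum>i\<le>k. F i * G (k - i))" for k
  proof -
    have "\<bar>fps_nth (f * g) k\<bar> * r ^ k \<le> (\<Sum>i=0..k. \<bar>fps_nth f i * fps_nth g (k - i)\<bar>) * r ^ k"
      unfolding fps_mult_nth using assms(3) by (intro mult_right_mono sum_abs) auto
    also have "\<dots> = (\<Sum>i\<le>k. F i * G (k - i))"
      unfolding sum_distrib_right F_def G_def atMost_atLeast0
    proof (rule sum.cong)
      fix i assume "i \<in> {0..k}"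
      then have "r ^ k = r ^ i * r ^ (k - i)" by (simp flip: power_add)
      then show "\<bar>fps_nth f i * fps_nth g (k - i)\<bar> * r ^ k
          = \<bar>fps_nth f i\<bar> * r ^ i * (\<bar>fps_nth g (k - i)\<bar> * r ^ (k - i))"
        by (simp add: abs_mult)
    qed simp
    finally show ?thesis .
  qed
  then have "(\<Sum>k<n. \<bar>fps_nth (f * g) k\<bar> * r ^ k) \<le> (\<Sum>k<n. \<Sum>i\<le>k. F i * G (k - i))"
    by (rule sum_mono)
  also have "\<dots> = (\<Sum>(i, j)\<in>{(i, j). i + j < n}. F i * G j)"
    by (rule sum.triangle_reindex[symmetric])
  also have "\<dots> \<le> (\<Sum>(i, j)\<in>{..<n} \<times> {..<n}. F i * G j)"
    using F0 G0 by (intro sum_mono2) auto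
  also have "\<dots> = (\<Sum>i<n. F i) * (\<Sum>j<n. G j)"
    by (simp add: sum_product sum.cartesian_product)
  also have "\<dots> \<le> M * N"
    using wnorm_leD[OF assms(1), of n] wnorm_leD[OF assms(2), of n] wnorm_le_nonneg[OF assms(1)] G0
    by (intro mult_mono sum_nonneg) (auto simp: F_def G_def)
  finally show "(\<Sum>k<n. \<bar>fps_nth (f * g) k\<bar> * r ^ k) \<le> M * N" .
qed

lemma wnorm_le_one_minus_X_squared:
  assumes "0 \<le> r"
  shows "wnorm_le r ((1 - fps_X)\<^sup>2) ((1 + r)\<^sup>2)"
proof -
  have "wnorm_le r (1 - fps_X) (1 + r)"
    by (intro wnorm_le_diff wnorm_le_1 wnorm_le_X assms)
  then show ?thesis
    unfolding power2_eq_square by (intro wnorm_le_mult assms)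
qed

section \<open>Division by \<open>1 - X\<close> and by its square\<close>

lemma fps_eq_one_minus_X_mult:
  fixes f :: "real fps"
  shows "f = (1 - fps_X) * Abs_fps (\<lambda>n. \<Sum>i\<le>n. fps_nth f i)"
proof (rule fps_ext)
  fix n
  show "fps_nth f n = fps_nth ((1 - fps_X) * Abs_fps (\<lambda>n. \<Sum>i\<le>n. fps_nth f i)) n"
    by (cases n) (simp_all add: left_diff_distrib)
qed

text \<open>Division by \<open>1 - X\<close> replaces coefficients by partial sums. As the total is
  0, each partial sum is minus a tail, and tails inherit the geometric decay that the weight
  \<open>r > 1\<close> imposes on \<open>f\<close>.\<close>

lemma wnorm_le_partial_sums:
  fixes f :: "real fps"
  assumes f: "wnorm_le r f M" and r: "1 < r" and sum0: "fps_nth f sums 0"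
  shows "wnorm_le r (Abs_fps (\<lambda>n. \<Sum>i\<le>n. fps_nth f i)) (M / (r - 1))"
proof -
  define F where "F n = (\<Sum>i\<le>n. fps_nth f i)" for n
  have F0: "F \<longlonglongrightarrow> 0"
    using sum0 unfolding sums_def_le F_def .
  \<comment> \<open>Minus \<open>F N\<close> is the sum of the coefficients beyond \<open>N\<close>,
    where the weights are at least \<open>r ^ N\<close>; the finite version with upper end
    \<open>L\<close> passes to the limit.\<close>
  have tail: "r ^ N * \<bar>F N\<bar> + (\<Sum>i\<le>N. \<bar>fps_nth f i\<bar> * r ^ i) \<le> M" for N
  proof (rule LIMSEQ_le_const)
    show "(\<lambda>L. r ^ N * \<bar>F L\<bar> + M) \<longlonglongrightarrow> M"
      using tendsto_add[OF tendsto_mult[OF tendsto_const[of "r ^ N"] tendsto_rabs[OF F0]] tendsto_const[of M]]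
      by simp
    show "\<exists>K. \<forall>L\<ge>K. r ^ N * \<bar>F N\<bar> + (\<Sum>i\<le>N. \<bar>fps_nth f i\<bar> * r ^ i) \<le> r ^ N * \<bar>F L\<bar> + M"
    proof (intro exI allI impI)
      fix L assume L: "N \<le> L"
      have split: "{..L} = {..N} \<union> {N<..L}" using L by auto
      have FL: "F L = F N + (\<Sum>i\<in>{N<..L}. fps_nth f i)"
        unfolding F_def split by (rule sum.union_disjoint) auto
      have "r ^ N * \<bar>\<Sum>i\<in>{N<..L}. fps_nth f i\<bar> \<le> r ^ N * (\<Sum>i\<in>{N<..L}. \<bar>fps_nth f i\<bar>)"
        using r by (intro mult_left_mono sum_abs) auto
      also have "\<dots> \<le> (\<Sum>i\<in>{N<..L}. \<bar>fps_nth f i\<bar> * r ^ i)"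
        unfolding sum_distrib_left
      proof (rule sum_mono)
        fix i assume "i \<in> {N<..L}"
        then have "r ^ N \<le> r ^ i" using r by (intro power_increasing) auto
        then show "r ^ N * \<bar>fps_nth f i\<bar> \<le> \<bar>fps_nth f i\<bar> * r ^ i"
          by (metis abs_ge_zero mult.commute mult_left_mono)
      qed
      finally have t: "r ^ N * \<bar>\<Sum>i\<in>{N<..L}. fps_nth f i\<bar> \<le> (\<Sum>i\<in>{N<..L}. \<bar>fps_nth f i\<bar> * r ^ i)" .
      have "\<bar>F N\<bar> \<le> \<bar>F L\<bar> + \<bar>\<Sum>i\<in>{N<..L}. fps_nth f i\<bar>" using FL by linarith
      then have "r ^ N * \<bar>F N\<bar> \<le> r ^ N * (\<bar>F L\<bar> + \<bar>\<Sum>i\<in>{N<..L}. fps_nth f i\<bar>)"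
        using r by (intro mult_left_mono) auto
      moreover have "(\<Sum>i\<le>L. \<bar>fps_nth f i\<bar> * r ^ i)
          = (\<Sum>i\<le>N. \<bar>fps_nth f i\<bar> * r ^ i) + (\<Sum>i\<in>{N<..L}. \<bar>fps_nth f i\<bar> * r ^ i)"
        unfolding split by (rule sum.union_disjoint) auto
      moreover have "(\<Sum>i\<le>L. \<bar>fps_nth f i\<bar> * r ^ i) \<le> M"
        using wnorm_leD[OF f, of "Suc L"] by (simp add: lessThan_Suc_atMost)
      ultimately show "r ^ N * \<bar>F N\<bar> + (\<Sum>i\<le>N. \<bar>fps_nth f i\<bar> * r ^ i) \<le> r ^ N * \<bar>F L\<bar> + M"
        using t by (simp add: distrib_left)
    qed
  qed
  have "(\<Sum>n<N. \<bar>F n\<bar> * r ^ n) \<le> M / (r - 1)" for N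
  proof -
    define S where "S = (\<Sum>n<N. \<bar>F n\<bar> * r ^ n)"
    \<comment> \<open>After a shift by one index, \<open>F n = F (Suc n) - f (Suc n)\<close> bounds
      \<open>r * S\<close> by \<open>S\<close> plus a boundary term and a partial norm of
      \<open>f\<close>; \<open>tail\<close> bounds these last two together by
      \<open>M\<close>.\<close>
    have "r * S = (\<Sum>n<N. \<bar>F n\<bar> * r ^ Suc n)"
      unfolding S_def sum_distrib_left by (simp add: mult_ac)
    also have "\<dots> \<le> (\<Sum>n<N. \<bar>F (Suc n)\<bar> * r ^ Suc n + \<bar>fps_nth f (Suc n)\<bar> * r ^ Suc n)"
    proof (rule sum_mono)
      fix n
      have "\<bar>F n\<bar> \<le> \<bar>F (Suc n)\<bar> + \<bar>fps_nth f (Suc n)\<bar>" by (simp add: F_def)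
      then have "\<bar>F n\<bar> * r ^ Suc n \<le> (\<bar>F (Suc n)\<bar> + \<bar>fps_nth f (Suc n)\<bar>) * r ^ Suc n"
        using r by (intro mult_right_mono) auto
      then show "\<bar>F n\<bar> * r ^ Suc n \<le> \<bar>F (Suc n)\<bar> * r ^ Suc n + \<bar>fps_nth f (Suc n)\<bar> * r ^ Suc n"
        by (simp add: distrib_right)
    qed
    also have "\<dots> = (\<Sum>n<N. \<bar>F (Suc n)\<bar> * r ^ Suc n) + (\<Sum>n<N. \<bar>fps_nth f (Suc n)\<bar> * r ^ Suc n)"
      by (rule sum.distrib)
    also have "(\<Sum>n<N. \<bar>F (Suc n)\<bar> * r ^ Suc n) = S + \<bar>F N\<bar> * r ^ N - \<bar>F 0\<bar>"
      using sum.lessThan_Suc_shift[of "\<lambda>n. \<bar>F n\<bar> * r ^ n" N] by (simp add: S_def)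
    also have "(\<Sum>n<N. \<bar>fps_nth f (Suc n)\<bar> * r ^ Suc n) \<le> (\<Sum>i\<le>N. \<bar>fps_nth f i\<bar> * r ^ i)"
      using sum.lessThan_Suc_shift[of "\<lambda>n. \<bar>fps_nth f n\<bar> * r ^ n" N]
      by (simp add: lessThan_Suc_atMost)
    finally have "(r - 1) * S \<le> M"
      using tail[of N] by (simp add: algebra_simps)
    then show ?thesis
      using r unfolding S_def by (simp add: pos_le_divide_eq mult.commute)
  qed
  then show ?thesis by (simp add: wnorm_le_def F_def)
qed

text \<open>The two sum conditions say that \<open>f\<close> has a double zero at 1. The first
  allows one division by \<open>1 - X\<close>; the second makes the quotient \<open>F\<close> vanish
  at 1, since \<open>F(1) = - f'(1)\<close>, and so allows another.\<close>

lemma wnorm_le_div_one_minus_X_squared: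
  fixes f :: "real fps"
  assumes f: "wnorm_le r f M" and r: "1 < r"
    and sum0: "fps_nth f sums 0" and dsum0: "fps_nth (fps_deriv f) sums 0"
  obtains g where "f = (1 - fps_X)\<^sup>2 * g" "wnorm_le r g (M / (r - 1)\<^sup>2)"
proof
  define F where "F = Abs_fps (\<lambda>n. \<Sum>i\<le>n. fps_nth f i)"
  define g where "g = Abs_fps (\<lambda>n. \<Sum>i\<le>n. fps_nth F i)"
  have F: "wnorm_le r F (M / (r - 1))"
    unfolding F_def by (rule wnorm_le_partial_sums[OF f r sum0])
  \<comment> \<open>Abel summation. In the limit it reads \<open>F(1) = - f'(1)\<close>, because the
    norm bound makes \<open>F N\<close> decay like \<open>(1 / r) ^ N\<close> and thus kills the
    boundary term.\<close>
  have abel: "(\<Sum>n<N. fps_nth F n) = real N * fps_nth F N - (\<Sum>n<N. fps_nth (fps_deriv f) n)" for N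
    by (induction N) (simp_all add: F_def algebra_simps)
  have "(\<lambda>N. real N * fps_nth F N) \<longlonglongrightarrow> 0"
  proof (rule Lim_null_comparison)
    show "\<forall>\<^sub>F N in sequentially. norm (real N * fps_nth F N) \<le> (M / (r - 1)) * (real N * (1 / r) ^ N)"
    proof (intro always_eventually allI)
      fix N
      have "\<bar>fps_nth F N\<bar> \<le> M / (r - 1) / r ^ N"
        using wnorm_le_nth[OF F, of N] r by (simp add: pos_le_divide_eq mult_ac)
      then have "real N * \<bar>fps_nth F N\<bar> \<le> real N * (M / (r - 1) / r ^ N)"
        by (intro mult_left_mono) auto
      then show "norm (real N * fps_nth F N) \<le> (M / (r - 1)) * (real N * (1 / r) ^ N)"
        by (simp add: abs_mult power_divide mult_ac)
    qed
    have "(\<lambda>N. real N * (1 / r) ^ N) \<longlonglongrightarrow> 0"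
      using r by (intro powser_times_n_limit_0) auto
    then show "(\<lambda>N. (M / (r - 1)) * (real N * (1 / r) ^ N)) \<longlonglongrightarrow> 0"
      by (rule tendsto_mult_right_zero)
  qed
  then have "(\<lambda>N. \<Sum>n<N. fps_nth F n) \<longlonglongrightarrow> 0 - 0"
    unfolding abel using dsum0 by (intro tendsto_diff) (simp_all add: sums_def)
  then have "fps_nth F sums 0" by (simp add: sums_def)
  then have "wnorm_le r g (M / (r - 1) / (r - 1))"
    unfolding g_def by (rule wnorm_le_partial_sums[OF F r])
  then show "wnorm_le r g (M / (r - 1)\<^sup>2)" by (simp add: power2_eq_square)
  have "f = (1 - fps_X) * ((1 - fps_X) * g)"
    using fps_eq_one_minus_X_mult[of f] fps_eq_one_minus_X_mult[of F]
    unfolding F_def[symmetric] g_def[symmetric] by metis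
  then show "f = (1 - fps_X)\<^sup>2 * g" by (simp add: power2_eq_square mult.assoc)
qed

section \<open>Poisson generating functions\<close>

text \<open>This is \<open>exp (a (X - 1))\<close>, with the constant \<open>exp (- a)\<close> split
  off. Negative \<open>a\<close> is intended: it gives the inverse of a Poisson generating
  function.\<close>

definition pois_fps :: "real \<Rightarrow> real fps" where
  "pois_fps a = fps_const (exp (- a)) * fps_exp a"

lemma pois_fps_nth: "fps_nth (pois_fps a) n = pois_prob a n"
  by (simp add: pois_fps_def pois_prob_def)

lemma pois_fps_0: "pois_fps 0 = 1"
  by (simp add: pois_fps_def)

lemma pois_fps_add: "pois_fps (a + b) = pois_fps a * pois_fps b"
proof -
  have "pois_fps a * pois_fps b = fps_const (exp (- a) * exp (- b)) * (fps_exp a * fps_exp b)"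
    by (simp add: pois_fps_def mult_ac flip: fps_const_mult)
  also have "exp (- a) * exp (- b) = exp (- (a + b))" by (simp flip: exp_add)
  finally show ?thesis by (simp add: pois_fps_def fps_exp_add_mult)
qed

lemma pois_fps_deriv: "fps_deriv (pois_fps a) = fps_const a * pois_fps a"
  by (simp add: pois_fps_def mult_ac)

text \<open>Valid for negative \<open>a\<close> as well: there \<open>r = 1\<close> supplies the
  evaluation at 1 needed for \<open>pois_fps (- a)\<close>.\<close>

lemma pois_prob_power_sums: "(\<lambda>n. pois_prob a n * r ^ n) sums exp ((r - 1) * a)"
proof -
  have "(\<lambda>n. exp (- a) * ((a * r) ^ n /\<^sub>R fact n)) sums (exp (- a) * exp (a * r))"
    by (intro sums_mult exp_converges)
  moreover have "exp (- a) * exp (a * r) = exp ((r - 1) * a)"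
    by (simp add: algebra_simps flip: exp_add)
  ultimately show ?thesis
    by (simp add: pois_prob_def field_simps power_mult_distrib)
qed

lemma wnorm_le_pois_fps:
  assumes "0 \<le> a" "0 \<le> r"
  shows "wnorm_le r (pois_fps a) (exp ((r - 1) * a))"
  using pois_prob_power_sums assms
  by (intro wnorm_le_sums[where g = "\<lambda>n. pois_prob a n * r ^ n"])
     (auto simp: pois_fps_nth pois_prob_def)

text \<open>In the proof \<open>f\<close> is the remainder of \<open>exp (a (1 - X))\<close> after
  the linear Taylor term at 1, so it has a double zero there. Its coefficients are O(a^2 / n!),
  hence its norm is O(a^2), and dividing by \<open>(1 - X)^2\<close> keeps that order.\<close>

lemma pois_fps_second_order:
  assumes a: "0 \<le> a" "a \<le> 1" and r: "1 < r"
  obtains g where "pois_fps (- a) = 1 - fps_const a * (fps_X - 1) + (1 - fps_X)\<^sup>2 * g"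
    "wnorm_le r g (3 * exp r / (r - 1)\<^sup>2 * a\<^sup>2)"
proof -
  define f where "f = pois_fps (- a) - 1 + fps_const a * (fps_X - 1)"
  have sum1: "fps_nth (pois_fps (- a)) sums 1"
    using pois_prob_power_sums[of "- a" 1] by (simp add: pois_fps_nth[abs_def])
  have nth: "fps_nth f n = pois_prob (- a) n + (if n = 0 then - 1 - a else if n = 1 then a else 0)" for n
    by (simp add: f_def pois_fps_nth fps_X_def algebra_simps)
  have e: "exp a \<le> 1 + a + a\<^sup>2" using exp_bound[OF a] .
  have aa: "a\<^sup>2 \<le> a" using a by (simp add: power2_eq_square mult_left_le)
  have e3: "exp a \<le> 3" using e a aa by linarith
  \<comment> \<open>For \<open>n \<ge> 2\<close> the power \<open>a ^ n\<close> supplies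
    \<open>a\<^sup>2\<close>. At 0 and 1 cancellation does, the coefficients being
    \<open>exp a - 1 - a\<close> and \<open>- a (exp a - 1)\<close>. The 3 covers
    \<open>exp a\<close> on [0, 1].\<close>
  have coeff: "\<bar>fps_nth f n\<bar> \<le> 3 * a\<^sup>2 / fact n" for n
  proof -
    consider "n = 0" | "n = 1" | m where "n = m + 2"
      by (metis One_nat_def Suc_1 add.commute add_2_eq_Suc' not0_implies_Suc)
    then show ?thesis
    proof cases
      case 1
      have "1 + a \<le> exp a" by (rule exp_ge_add_one_self)
      then have "\<bar>exp a + (- 1 - a)\<bar> \<le> 3 * a\<^sup>2"
        using e zero_le_power2[of a] by linarith
      then show ?thesis using 1 by (simp add: nth pois_prob_def)
    next
      case 2
      have "a * (exp a - 1) \<le> a * (a + a)" using e aa a by (intro mult_left_mono) auto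
      moreover have "0 \<le> a * (exp a - 1)" using a by simp
      ultimately show ?thesis using 2 a by (simp add: nth pois_prob_def power2_eq_square algebra_simps)
    next
      case 3
      have "a ^ n * exp a \<le> a\<^sup>2 * 3"
        using a e3 3 by (intro mult_mono power_decreasing) auto
      then show ?thesis
        using a 3 by (simp add: nth pois_prob_def abs_mult power_abs divide_right_mono mult.commute)
    qed
  qed
  have "wnorm_le r f (3 * a\<^sup>2 * exp r)"
  proof (rule wnorm_le_sums)
    show "(\<lambda>n. 3 * a\<^sup>2 * (r ^ n /\<^sub>R fact n)) sums (3 * a\<^sup>2 * exp r)"
      by (intro sums_mult exp_converges)
    show "\<bar>fps_nth f n\<bar> * r ^ n \<le> 3 * a\<^sup>2 * (r ^ n /\<^sub>R fact n)" for n
      using mult_right_mono[OF coeff[of n], of "r ^ n"] r by (simp add: field_simps)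
  qed (use r in simp)
  moreover have "fps_nth f sums 0"
  proof -
    have "(\<lambda>n. (if n = 0 then - 1 - a else if n = 1 then a else 0)) sums
        (\<Sum>n\<in>{0, 1::nat}. (if n = 0 then - 1 - a else if n = 1 then a else 0))"
      by (rule sums_finite) auto
    from sums_add[OF sum1 this] show ?thesis
      by (simp add: nth[abs_def] pois_fps_nth[abs_def])
  qed
  moreover have "fps_nth (fps_deriv f) sums 0"
  proof -
    \<comment> \<open>At 1 this derivative is \<open>a - a\<close>, as the coefficients of
      \<open>pois_fps (- a)\<close> sum to 1.\<close>
    have "fps_deriv f = fps_const a - fps_const a * pois_fps (- a)"
      by (simp add: f_def pois_fps_deriv flip: fps_const_neg)
    moreover have "(\<lambda>n. (if n = 0 then a else 0) - a * fps_nth (pois_fps (- a)) n) sums (a - a * 1)"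
      using sums_single[of 0 "\<lambda>_. a"] by (intro sums_diff sums_mult sum1) simp
    ultimately show ?thesis
      by (simp add: sums_def)
  qed
  ultimately obtain g where g: "f = (1 - fps_X)\<^sup>2 * g" "wnorm_le r g (3 * a\<^sup>2 * exp r / (r - 1)\<^sup>2)"
    using wnorm_le_div_one_minus_X_squared[OF _ r] by blast
  show thesis
  proof
    show "pois_fps (- a) = 1 - fps_const a * (fps_X - 1) + (1 - fps_X)\<^sup>2 * g"
      unfolding g(1)[symmetric] f_def by simp
    show "wnorm_le r g (3 * exp r / (r - 1)\<^sup>2 * a\<^sup>2)"
      using g(2) by (simp add: mult_ac)
  qed
qed

section \<open>Products of second-order perturbations of 1\<close>

text \<open>With \<open>D = (1 - X)^2\<close>, the identity
  \<open>(1 + D u) (1 + D h) = 1 + D (u + (1 + D u) h)\<close> drives the induction. The bound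
  \<open>S exp (q S)\<close>, with \<open>q\<close> the norm bound of \<open>D\<close>, is stable
  under it and linear in \<open>S\<close> up to a factor that is bounded when \<open>S\<close>
  is.\<close>

lemma wnorm_le_prod_second_order:
  fixes g :: "'a \<Rightarrow> real fps" and b :: "'a \<Rightarrow> real"
  assumes "finite T" "0 \<le> r"
    and "\<And>p. p \<in> T \<Longrightarrow> \<exists>u. g p = 1 + (1 - fps_X)\<^sup>2 * u \<and> wnorm_le r u (b p)"
  shows "\<exists>h. (\<Prod>p\<in>T. g p) = 1 + (1 - fps_X)\<^sup>2 * h \<and>
    wnorm_le r h (sum b T * exp ((1 + r)\<^sup>2 * sum b T))"
  using assms(1,3)
proof (induction T rule: finite_induct)
  case empty
  then show ?case using wnorm_le_const[of r 0] by (intro exI[of _ 0]) auto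
next
  case (insert p T)
  define S where "S = sum b T"
  define q where "q = (1 + r)\<^sup>2"
  have q0: "0 \<le> q" by (simp add: q_def)
  from insert obtain h where h: "(\<Prod>p\<in>T. g p) = 1 + (1 - fps_X)\<^sup>2 * h" "wnorm_le r h (S * exp (q * S))"
    unfolding S_def q_def by blast
  from insert.prems obtain u where u: "g p = 1 + (1 - fps_X)\<^sup>2 * u" "wnorm_le r u (b p)"
    by blast
  have S0: "0 \<le> S"
    unfolding S_def using insert.prems by (intro sum_nonneg) (meson insertI2 wnorm_le_nonneg)
  have b0: "0 \<le> b p" using u(2) by (rule wnorm_le_nonneg)
  have "wnorm_le r (u + (1 + (1 - fps_X)\<^sup>2 * u) * h) (b p + (1 + q * b p) * (S * exp (q * S)))"
    unfolding q_def
    by (intro wnorm_le_add wnorm_le_mult wnorm_le_1 wnorm_le_one_minus_X_squared u(2)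
        h(2)[unfolded q_def] assms(2))
  moreover have "b p + (1 + q * b p) * (S * exp (q * S)) \<le> (b p + S) * exp (q * (b p + S))"
  proof -
    have "b p * 1 \<le> b p * exp (q * (b p + S))"
      using b0 S0 q0 by (intro mult_left_mono) auto
    moreover have "(1 + q * b p) * (S * exp (q * S)) \<le> exp (q * b p) * (S * exp (q * S))"
      using S0 by (intro mult_right_mono exp_ge_add_one_self) auto
    ultimately show ?thesis by (simp add: algebra_simps exp_add)
  qed
  ultimately have "wnorm_le r (u + (1 + (1 - fps_X)\<^sup>2 * u) * h) ((b p + S) * exp (q * (b p + S)))"
    by (rule wnorm_le_mono)
  moreover have "(\<Prod>p\<in>insert p T. g p) = 1 + (1 - fps_X)\<^sup>2 * (u + (1 + (1 - fps_X)\<^sup>2 * u) * h)"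
    using insert.hyps by (simp add: h(1) u(1) algebra_simps)
  ultimately show ?case
    using insert.hyps by (auto simp: S_def q_def)
qed

section \<open>Generating functions of sums over the Kubilius model\<close>

text \<open>Convolution formula for independent summands, in the shape that splitting one coordinate
  off \<open>Pi_pmf\<close> produces.\<close>

lemma pmf_bind_add_nat:
  fixes A B :: "nat pmf"
  shows "pmf (bind_pmf A (\<lambda>a. map_pmf ((+) a) B)) k = (\<Sum>i\<le>k. pmf A i * pmf B (k - i))"
proof -
  have *: "pmf (map_pmf ((+) a) B) k = (if a \<le> k then pmf B (k - a) else 0)" for a
  proof (cases "a \<le> k")
    case True
    then show ?thesis using pmf_map_inj'[of "(+) a" B "k - a"] by simp
  next
    case False
    then have "k \<notin> (+) a ` set_pmf B" by auto
    then show ?thesis using False by (simp add: pmf_eq_0_set_pmf)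
  qed
  have "pmf (bind_pmf A (\<lambda>a. map_pmf ((+) a) B)) k = (\<Sum>a\<le>k. pmf A a * (if a \<le> k then pmf B (k - a) else 0))"
    unfolding pmf_bind *
    by (subst integral_measure_pmf[where A = "{..k}"]) (auto split: if_splits)
  then show ?thesis by simp
qed

text \<open>Coordinates split off one at a time as independent summands, and convolution is
  multiplication of series. Leaving \<open>f\<close> free covers an indicator for
  \<open>U_law\<close> and the identity for \<open>W_law\<close>.\<close>

lemma pgf_sum_Pi_pmf:
  fixes f :: "'b \<Rightarrow> nat"
  assumes "finite T"
  shows "Abs_fps (pmf (map_pmf (\<lambda>X. \<Sum>p\<in>T. f (X p)) (Pi_pmf T d q)))
    = (\<Prod>p\<in>T. Abs_fps (pmf (map_pmf f (q p))))"
  using assms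
proof (induction T rule: finite_induct)
  case empty
  show ?case by (rule fps_ext) (simp add: pmf_return)
next
  case (insert p T)
  define S where "S = map_pmf (\<lambda>X. \<Sum>p\<in>T. f (X p)) (Pi_pmf T d q)"
  have "map_pmf (\<lambda>X. \<Sum>p\<in>insert p T. f (X p)) (Pi_pmf (insert p T) d q)
      = bind_pmf (q p) (\<lambda>y. map_pmf (\<lambda>X. f y + (\<Sum>t\<in>T. f (X t))) (Pi_pmf T d q))"
  proof -
    \<comment> \<open>The value placed at \<open>p\<close> does not reach the sum over
      \<open>T\<close>, as \<open>p \<notin> T\<close>.\<close>
    have "(\<Sum>t\<in>T. f (if t = p then y else X t)) = (\<Sum>t\<in>T. f (X t))" for X y
      using insert.hyps by (intro sum.cong) auto
    then show ?thesis
      using insert.hyps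
      by (simp add: Pi_pmf_insert' map_bind_pmf map_pmf_def[symmetric] pmf.map_comp o_def)
  qed
  also have "\<dots> = bind_pmf (map_pmf f (q p)) (\<lambda>a. map_pmf ((+) a) S)"
    by (simp add: S_def bind_map_pmf pmf.map_comp o_def)
  finally have eq: "map_pmf (\<lambda>X. \<Sum>p\<in>insert p T. f (X p)) (Pi_pmf (insert p T) d q)
      = bind_pmf (map_pmf f (q p)) (\<lambda>a. map_pmf ((+) a) S)" .
  have "Abs_fps (pmf (bind_pmf (map_pmf f (q p)) (\<lambda>a. map_pmf ((+) a) S)))
      = Abs_fps (pmf (map_pmf f (q p))) * Abs_fps (pmf S)"
    by (rule fps_ext) (simp add: pmf_bind_add_nat fps_mult_nth atMost_atLeast0)
  then show ?case
    unfolding eq using insert by (simp add: S_def)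
qed

text \<open>Each factor is compared with its own Poisson law through
  \<open>pois_fps (- a p)\<close>, the inverse of \<open>pois_fps (a p)\<close>. Multiplying back
  adds the parameters up to \<open>sum a T\<close>.\<close>

lemma prod_eq_pois_fps_perturbation:
  fixes G :: "'a \<Rightarrow> real fps" and a b :: "'a \<Rightarrow> real"
  assumes "finite T" "0 \<le> r"
    and "\<And>p. p \<in> T \<Longrightarrow> \<exists>u. G p * pois_fps (- a p) = 1 + (1 - fps_X)\<^sup>2 * u \<and> wnorm_le r u (b p)"
  obtains h where "(\<Prod>p\<in>T. G p) = pois_fps (sum a T) + (1 - fps_X)\<^sup>2 * h * pois_fps (sum a T)"
    "wnorm_le r h (sum b T * exp ((1 + r)\<^sup>2 * sum b T))"
proof -
  obtain h where h: "(\<Prod>p\<in>T. G p * pois_fps (- a p)) = 1 + (1 - fps_X)\<^sup>2 * h"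
    "wnorm_le r h (sum b T * exp ((1 + r)\<^sup>2 * sum b T))"
    using wnorm_le_prod_second_order[of T r "\<lambda>p. G p * pois_fps (- a p)" b] assms by blast
  have P: "pois_fps (sum a T) = (\<Prod>p\<in>T. pois_fps (a p))"
    using assms(1) by (induction T rule: finite_induct) (simp_all add: pois_fps_0 pois_fps_add)
  have "G p * pois_fps (- a p) * pois_fps (a p) = G p" for p
    by (simp add: mult.assoc pois_fps_0 flip: pois_fps_add)
  then have "(\<Prod>p\<in>T. G p) = (\<Prod>p\<in>T. G p * pois_fps (- a p)) * pois_fps (sum a T)"
    unfolding P prod.distrib[symmetric] by (simp only:)
  also have "\<dots> = pois_fps (sum a T) + (1 - fps_X)\<^sup>2 * h * pois_fps (sum a T)"
    by (simp add: h(1) algebra_simps)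
  finally show thesis using h(2) that by blast
qed

text \<open>The count is a sum of independent indicators of \<open>X p \<ge> 1\<close>, each
  Bernoulli with parameter \<open>1 / p\<close>.\<close>

lemma U_law_pgf:
  assumes "finite T" "\<And>p. p \<in> T \<Longrightarrow> 2 \<le> p"
  shows "Abs_fps (pmf (U_law T)) = (\<Prod>p\<in>T. 1 + fps_const (1 / real p) * (fps_X - 1))"
proof -
  define f :: "nat \<Rightarrow> nat" where "f x = (if 1 \<le> x then 1 else 0)" for x
  have "card {p \<in> T. 1 \<le> X p} = (\<Sum>p\<in>T. f (X p))" for X
    using assms(1) by (simp add: f_def sum.If_cases Int_def)
  then have "Abs_fps (pmf (U_law T))
      = (\<Prod>p\<in>T. Abs_fps (pmf (map_pmf f (geometric_pmf (1 - 1 / real p)))))"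
    unfolding U_law_def kubilius_def by (simp add: pgf_sum_Pi_pmf[OF assms(1)])
  also have "\<dots> = (\<Prod>p\<in>T. 1 + fps_const (1 / real p) * (fps_X - 1))"
  proof (intro prod.cong refl fps_ext)
    fix p k assume "p \<in> T"
    then have p: "0 < 1 - 1 / real p" "1 - 1 / real p \<le> 1" using assms(2)[of p] by auto
    define Q where "Q = map_pmf f (geometric_pmf (1 - 1 / real p))"
    \<comment> \<open>\<open>geometric_pmf\<close> counts failures from 0, so the indicator is 0
      exactly at the outcome 0. The mass at 1 follows by complement, the support lying in {0,
      1}.\<close>
    have "pmf Q 0 = measure (geometric_pmf (1 - 1 / real p)) {0}"
      unfolding Q_def pmf_map by (intro arg_cong2[where f = measure]) (auto simp: f_def split: if_splits)
    then have Q0: "pmf Q 0 = 1 - 1 / real p"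
      using p by (simp add: measure_pmf_single)
    have sub: "set_pmf Q \<subseteq> {0, 1}" by (auto simp: Q_def f_def)
    have "(\<Sum>k\<in>{0, 1}. pmf Q k) = 1"
      using sub by (intro sum_pmf_eq_1) auto
    then have Q1: "pmf Q 1 = 1 / real p" using Q0 by simp
    have "pmf Q k = 0" if "k \<noteq> 0" "k \<noteq> 1"
      using sub that by (auto simp: pmf_eq_0_set_pmf)
    then show "fps_nth (Abs_fps (pmf (map_pmf f (geometric_pmf (1 - 1 / real p))))) k
        = fps_nth (1 + fps_const (1 / real p) * (fps_X - 1)) k"
      using Q0 Q1 unfolding Q_def[symmetric]
      by (cases "k = 0"; cases "k = 1") (simp_all add: fps_X_def)
  qed
  finally show ?thesis .
qed

lemma W_law_pgf:
  assumes "finite T" "\<And>p. p \<in> T \<Longrightarrow> 2 \<le> p"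
  shows "Abs_fps (pmf (W_law T)) = (\<Prod>p\<in>T. Abs_fps (\<lambda>n. (1 - 1 / real p) * (1 / real p) ^ n))"
proof -
  have "Abs_fps (pmf (W_law T))
      = (\<Prod>p\<in>T. Abs_fps (pmf (geometric_pmf (1 - 1 / real p))))"
    unfolding W_law_def kubilius_def using pgf_sum_Pi_pmf[OF assms(1), of "\<lambda>x. x"] by simp
  also have "\<dots> = (\<Prod>p\<in>T. Abs_fps (\<lambda>n. (1 - 1 / real p) * (1 / real p) ^ n))"
    using assms(2) by (intro prod.cong refl fps_ext) (force simp: mult.commute)
  finally show ?thesis .
qed

section \<open>Local factors at a single prime\<close>

lemma U_factor_second_order:
  fixes r a :: real
  assumes a: "0 \<le> a" "a \<le> 1" and r: "1 < r"
  shows "\<exists>u. (1 + fps_const a * (fps_X - 1)) * pois_fps (- a) = 1 + (1 - fps_X)\<^sup>2 * u \<and>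
    wnorm_le r u ((1 + (2 + r) * (3 * exp r / (r - 1)\<^sup>2)) * a\<^sup>2)"
proof -
  define K where "K = 3 * exp r / (r - 1)\<^sup>2"
  obtain g where g: "pois_fps (- a) = 1 - fps_const a * (fps_X - 1) + (1 - fps_X)\<^sup>2 * g"
    "wnorm_le r g (K * a\<^sup>2)"
    using pois_fps_second_order[OF a r] unfolding K_def by blast
  define A where "A = fps_const a"
  \<comment> \<open>The linear terms \<open>A (X - 1)\<close> of the Bernoulli factor and of
    \<open>pois_fps (- a)\<close> cancel. Their product leaves \<open>- A * A\<close>, and the
    remainder \<open>g\<close> is carried along by the Bernoulli factor.\<close>
  define u where "u = (1 + A * (fps_X - 1)) * g - A * A"
  have "(1 + A * (fps_X - 1)) * pois_fps (- a) = 1 + (1 - fps_X)\<^sup>2 * u"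
    unfolding g(1) u_def A_def[symmetric] by (simp add: algebra_simps power2_eq_square)
  moreover have "wnorm_le r u ((1 + \<bar>a\<bar> * (r + 1)) * (K * a\<^sup>2) + \<bar>a\<bar> * \<bar>a\<bar>)"
    unfolding u_def A_def using r
    by (intro wnorm_le_add wnorm_le_diff wnorm_le_mult wnorm_le_1 wnorm_le_X wnorm_le_const g(2)) auto
  moreover have "(1 + \<bar>a\<bar> * (r + 1)) * (K * a\<^sup>2) + \<bar>a\<bar> * \<bar>a\<bar> \<le> (1 + (2 + r) * K) * a\<^sup>2"
  proof -
    have "\<bar>a\<bar> * (r + 1) \<le> 1 * (r + 1)" using a r by (intro mult_right_mono) auto
    then have "(1 + \<bar>a\<bar> * (r + 1)) * (K * a\<^sup>2) \<le> (2 + r) * (K * a\<^sup>2)"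
      by (intro mult_right_mono) (auto simp: K_def)
    then show ?thesis by (simp add: algebra_simps power2_eq_square)
  qed
  ultimately show ?thesis
    unfolding K_def[symmetric] A_def by (blast intro: wnorm_le_mono)
qed

text \<open>With \<open>a = 1 / (p - 1)\<close> the geometric series is
  \<open>L = 1 / (1 - a (X - 1))\<close>, whose denominator is exactly the linear Taylor part of
  \<open>pois_fps (- a)\<close>. So the perturbation is just \<open>L * g\<close>, and
  \<open>r < 2\<close> bounds the norm of \<open>L\<close> uniformly in
  \<open>p \<ge> 2\<close>.\<close>

lemma W_factor_second_order:
  fixes r :: real and p :: nat
  assumes p: "2 \<le> p" and r: "1 < r" "r < 2"
  shows "\<exists>u. Abs_fps (\<lambda>n. (1 - 1 / real p) * (1 / real p) ^ n) * pois_fps (- (1 / (real p - 1)))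
      = 1 + (1 - fps_X)\<^sup>2 * u \<and>
    wnorm_le r u (1 / (1 - r / 2) * (3 * exp r / (r - 1)\<^sup>2) * (1 / (real p - 1))\<^sup>2)"
proof -
  define a where "a = 1 / (real p - 1)"
  define L where "L = Abs_fps (\<lambda>n. (1 - 1 / real p) * (1 / real p) ^ n)"
  have a: "0 \<le> a" "a \<le> 1" using p by (auto simp: a_def)
  obtain g where g: "pois_fps (- a) = 1 - fps_const a * (fps_X - 1) + (1 - fps_X)\<^sup>2 * g"
    "wnorm_le r g (3 * exp r / (r - 1)\<^sup>2 * a\<^sup>2)"
    using pois_fps_second_order[OF a r(1)] by blast
  have "L * (fps_const (1 + a) - fps_const a * fps_X) = 1"
  proof (rule fps_ext)
    fix n
    \<comment> \<open>As \<open>1 + a = p / (p - 1)\<close>, the first identity settles the constant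
      coefficient and the second all higher ones.\<close>
    have a1: "(1 - 1 / real p) * (1 + a) = 1" "(1 + a) / real p = a"
      using p by (simp_all add: a_def field_simps)
    have e: "L * (fps_const (1 + a) - fps_const a * fps_X) = fps_const (1 + a) * L - fps_const a * (fps_X * L)"
      by (simp add: right_diff_distrib mult_ac)
    show "fps_nth (L * (fps_const (1 + a) - fps_const a * fps_X)) n = fps_nth 1 n"
    proof (cases n)
      case 0
      then show ?thesis unfolding e using a1(1) by (simp add: L_def mult.commute)
    next
      case (Suc m)
      define w where "w = (1 - 1 / real p) * (1 / real p) ^ m"
      have "fps_nth L m = w" "fps_nth L (Suc m) = w / real p" by (simp_all add: L_def w_def)
      then have "fps_nth (L * (fps_const (1 + a) - fps_const a * fps_X)) n = (1 + a) * (w / real p) - a * w"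
        unfolding e Suc by simp
      also have "\<dots> = ((1 + a) / real p - a) * w"
        by (simp add: left_diff_distrib)
      finally show ?thesis using a1(2) Suc by simp
    qed
  qed
  then have inv: "L * (1 - fps_const a * (fps_X - 1)) = 1"
    by (simp add: algebra_simps flip: fps_const_add)
  have "L * pois_fps (- a) = L * (1 - fps_const a * (fps_X - 1)) + (1 - fps_X)\<^sup>2 * (L * g)"
    unfolding g(1) by (simp add: algebra_simps)
  then have "L * pois_fps (- a) = 1 + (1 - fps_X)\<^sup>2 * (L * g)" by (simp add: inv)
  moreover have "wnorm_le r L (1 / (1 - r / 2))"
  proof (rule wnorm_le_sums)
    show "(\<lambda>n. (r / 2) ^ n) sums (1 / (1 - r / 2))"
      using r by (intro geometric_sums) auto
    fix n
    have "(1 - 1 / real p) * (r / real p) ^ n \<le> 1 * (r / 2) ^ n"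
      using p r by (intro mult_mono power_mono divide_left_mono) auto
    then show "\<bar>fps_nth L n\<bar> * r ^ n \<le> (r / 2) ^ n"
      using p by (simp add: L_def abs_mult power_divide)
  qed (use r in simp)
  then have "wnorm_le r (L * g) (1 / (1 - r / 2) * (3 * exp r / (r - 1)\<^sup>2 * a\<^sup>2))"
    using g(2) r by (intro wnorm_le_mult) auto
  ultimately show ?thesis
    unfolding L_def[symmetric] a_def[symmetric] mult.assoc by blast
qed

section \<open>Second differences of Poisson probabilities\<close>

lemma pois_prob_Suc: "pois_prob l (Suc m) = l / real (Suc m) * pois_prob l m"
  by (simp add: pois_prob_def)

text \<open>Since \<open>\<pi>(m - 1) = (m / l) \<pi>(m)\<close>, the second difference is
  \<open>\<pi>(m)\<close> times \<open>1 - 2 m / l + m (m - 1) / l^2\<close>, a Charlier polynomial,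
  rewritten around its square. The factors \<open>m\<close> and \<open>m (m - 1)\<close> vanish
  where the lagged terms are absent.\<close>

lemma pois_second_difference:
  assumes "0 < l"
  shows "fps_nth ((1 - fps_X)\<^sup>2 * pois_fps l) m
    = pois_prob l m * (((real m - l) / l)\<^sup>2 - real m / l\<^sup>2)"
proof -
  have e: "(1 - fps_X)\<^sup>2 * pois_fps l = pois_fps l - 2 * (fps_X * pois_fps l) + fps_X * (fps_X * pois_fps l)"
    by (simp add: power2_eq_square algebra_simps)
  have two: "fps_nth (2 * f) n = 2 * fps_nth f n" for f :: "real fps" and n
    by (simp add: numeral_fps_const)
  consider "m = 0" | "m = 1" | j where "m = Suc (Suc j)"
    by (metis One_nat_def not0_implies_Suc)
  then show ?thesis
  proof cases
    case (3 j)
    define P where "P = pois_prob l j"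
    define x where "x = real j + 1"
    define y where "y = x + 1"
    have x: "0 < x" and y: "0 < y" by (simp_all add: x_def y_def)
    have P1: "pois_prob l (Suc j) = l / x * P"
      by (simp add: pois_prob_Suc P_def x_def add.commute)
    have P2: "pois_prob l (Suc (Suc j)) = l / y * (l / x * P)"
      unfolding pois_prob_Suc[of l "Suc j"] P1 by (simp add: x_def y_def add_ac)
    have m: "real m = y" by (simp add: 3 x_def y_def)
    have "fps_nth ((1 - fps_X)\<^sup>2 * pois_fps l) m
        = l / y * (l / x * P) - 2 * (l / x * P) + P"
      unfolding e using 3 P1 P2 by (simp add: two pois_fps_nth P_def)
    also have "\<dots> = P / (x * y) * (l * l - 2 * l * y + x * y)"
      using x y by (simp add: field_simps)
    also have "l * l - 2 * l * y + x * y = (y - l)\<^sup>2 - y"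
      by (simp add: y_def algebra_simps power2_eq_square)
    also have "P / (x * y) * ((y - l)\<^sup>2 - y) = l / y * (l / x * P) * (((y - l)\<^sup>2 - y) / l\<^sup>2)"
      using assms by (simp add: power2_eq_square)
    also have "((y - l)\<^sup>2 - y) / l\<^sup>2 = ((y - l) / l)\<^sup>2 - y / l\<^sup>2"
      unfolding power_divide by (rule diff_divide_distrib)
    finally show ?thesis unfolding m using 3 P2 by simp
  qed (use assms in \<open>simp_all add: e two pois_fps_nth pois_prob_def field_simps power2_eq_square\<close>)
qed

text \<open>A step down from \<open>m\<close> to \<open>m - 1\<close> multiplies the weight by
  \<open>m / l\<close>, and \<open>m \<le> k \<le> c l\<close>.\<close>

lemma pois_prob_diff_le:
  assumes "0 < l" "0 \<le> c" "real k \<le> c * l" "j \<le> k"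
  shows "pois_prob l (k - j) \<le> c ^ j * pois_prob l k"
  using assms(4)
proof (induction j)
  case (Suc j)
  define m where "m = k - Suc j"
  have m: "k - j = Suc m" using Suc.prems by (simp add: m_def)
  have "pois_prob l m = real (Suc m) / l * pois_prob l (Suc m)"
    using assms(1) by (simp add: pois_prob_Suc)
  also have "\<dots> \<le> c * pois_prob l (Suc m)"
  proof (rule mult_right_mono)
    have "real (Suc m) \<le> c * l" using assms(3) m by linarith
    then show "real (Suc m) / l \<le> c" using assms(1) by (simp add: pos_divide_le_eq)
  qed (use assms(1) in \<open>simp add: pois_prob_def\<close>)
  also have "\<dots> \<le> c * (c ^ j * pois_prob l k)"
    using Suc m assms(2) by (intro mult_left_mono) auto
  finally show ?case by (simp add: m_def)
qed simp

text \<open>Moving from \<open>k\<close> to \<open>k - j\<close> costs \<open>1.9 ^ j\<close> in the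
  Poisson weight and a factor of order \<open>1 + j\<^sup>2\<close> in the bracket, so the bound can
  refer to \<open>k\<close> outside a factor in \<open>j\<close>.\<close>

lemma pois_second_difference_le:
  assumes l: "0 < l" and k: "real k \<le> 1.9 * l" and j: "j \<le> k"
  shows "\<bar>fps_nth ((1 - fps_X)\<^sup>2 * pois_fps l) (k - j)\<bar>
    \<le> 16 * (1.9 ^ j * (1 + (real j)\<^sup>2)) * (pois_prob l k * (1 / (real k + 1) + ((real k - l) / l)\<^sup>2))"
proof -
  define D where "D = ((real k - l) / l)\<^sup>2"
  define E where "E = 1 / (real k + 1)"
  have DE: "0 \<le> D" "0 \<le> E" by (simp_all add: D_def E_def)
  have k2: "(real k)\<^sup>2 \<le> 4 * l\<^sup>2"
  proof -
    have "(real k)\<^sup>2 \<le> (2 * l)\<^sup>2" using k l by (intro power_mono) auto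
    then show ?thesis by (simp add: power_mult_distrib)
  qed
  have kk: "real k \<le> (real k)\<^sup>2" by (cases k) (auto simp: power2_eq_square)
  \<comment> \<open>By \<open>k \<le> 2 l\<close>,
    \<open>k (k + 1) \<le> 2 k\<^sup>2 \<le> 8 l\<^sup>2\<close>; this is how
    \<open>1 / (k + 1)\<close> enters.\<close>
  have b1: "real k / l\<^sup>2 \<le> 8 * E"
    using k2 kk l by (simp add: E_def field_simps power2_eq_square)
  \<comment> \<open>For \<open>k \<ge> 1\<close>,
    \<open>k + 1 \<le> 2 k\<^sup>2 \<le> 8 l\<^sup>2\<close>. For \<open>k = 0\<close> nothing keeps
    \<open>l\<close> away from 0, but then \<open>j = 0\<close> and both sides vanish.\<close>
  have b2: "(real j)\<^sup>2 / l\<^sup>2 \<le> 8 * E * (real j)\<^sup>2"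
  proof (cases "k = 0")
    case False
    then have "real k + 1 \<le> 2 * real k" by simp
    then have "real k + 1 \<le> 8 * l\<^sup>2" using k2 kk by linarith
    then have "1 / l\<^sup>2 \<le> 8 * E"
      using l by (simp add: E_def field_simps)
    from mult_right_mono[OF this, of "(real j)\<^sup>2"] show ?thesis by simp
  qed (use j in simp)
  have b3: "((real (k - j) - l) / l)\<^sup>2 \<le> 2 * D + 2 * ((real j)\<^sup>2 / l\<^sup>2)"
  proof -
    have sq: "(x - y)\<^sup>2 \<le> 2 * x\<^sup>2 + 2 * y\<^sup>2" for x y :: real
      using zero_le_power2[of "x + y"] by (simp add: power2_eq_square algebra_simps)
    have "(real (k - j) - l) / l = (real k - l) / l - real j / l"
      using j l by (simp add: of_nat_diff field_simps)
    then show ?thesis using sq[of "(real k - l) / l" "real j / l"] by (simp add: D_def power_divide)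
  qed
  have b4: "real (k - j) / l\<^sup>2 \<le> real k / l\<^sup>2" by (intro divide_right_mono) auto
  have "\<bar>((real (k - j) - l) / l)\<^sup>2 - real (k - j) / l\<^sup>2\<bar>
      \<le> ((real (k - j) - l) / l)\<^sup>2 + real (k - j) / l\<^sup>2"
    using abs_triangle_ineq4[of "((real (k - j) - l) / l)\<^sup>2" "real (k - j) / l\<^sup>2"] by simp
  also have "\<dots> \<le> 2 * D + 16 * E * (real j)\<^sup>2 + 8 * E"
    using b1 b2 b3 b4 by linarith
  also have "\<dots> \<le> 16 * (1 + (real j)\<^sup>2) * (E + D)"
    using DE mult_nonneg_nonneg[OF DE(1) zero_le_power2[of "real j"]] by (simp add: algebra_simps)
  finally have main: "\<bar>((real (k - j) - l) / l)\<^sup>2 - real (k - j) / l\<^sup>2\<bar> \<le> 16 * (1 + (real j)\<^sup>2) * (E + D)" .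
  have "\<bar>fps_nth ((1 - fps_X)\<^sup>2 * pois_fps l) (k - j)\<bar>
      = pois_prob l (k - j) * \<bar>((real (k - j) - l) / l)\<^sup>2 - real (k - j) / l\<^sup>2\<bar>"
    using l by (simp add: pois_second_difference abs_mult) (simp add: pois_prob_def)
  also have "\<dots> \<le> (1.9 ^ j * pois_prob l k) * (16 * (1 + (real j)\<^sup>2) * (E + D))"
    using l k j main by (intro mult_mono pois_prob_diff_le) (auto simp: pois_prob_def)
  finally show ?thesis by (simp only: D_def E_def mult_ac)
qed

section \<open>From a norm bound to a pointwise bound\<close>

lemma poly_power_le_power:
  obtains K :: real where "0 < K" "\<And>j. 1.9 ^ j * (1 + (real j)\<^sup>2) \<le> K * 1.95 ^ j"
proof -
  have "(\<lambda>j. (1 + (real j)\<^sup>2) * (1.9 / 1.95) ^ j) \<longlonglongrightarrow> 0"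
    by real_asymp
  then have "Bseq (\<lambda>j. (1 + (real j)\<^sup>2) * (1.9 / 1.95) ^ j)"
    by (intro convergent_imp_Bseq convergentI)
  then obtain K where K: "0 < K" "\<And>j. norm ((1 + (real j)\<^sup>2) * (1.9 / 1.95 :: real) ^ j) \<le> K"
    unfolding Bseq_def by blast
  have "1.9 ^ j * (1 + (real j)\<^sup>2) \<le> K * 1.95 ^ j" for j
  proof -
    have "(1 + (real j)\<^sup>2) * (1.9 / 1.95) ^ j \<le> K" using K(2)[of j] by (simp only: real_norm_def abs_le_iff)
    from mult_right_mono[OF this, of "1.95 ^ j"]
    have "(1 + (real j)\<^sup>2) * ((1.9 / 1.95) ^ j * 1.95 ^ j) \<le> K * 1.95 ^ j"
      by (simp only: mult.assoc) simp
    moreover have "(1.9 / 1.95) ^ j * 1.95 ^ j = (1.9 :: real) ^ j"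
      by (simp flip: power_mult_distrib)
    ultimately show ?thesis by (simp only: mult.commute)
  qed
  with K(1) show thesis by (rule that)
qed

text \<open>The condition at \<open>l = 0\<close> accounts for the empty set of primes: it forces
  \<open>h\<close> to vanish there, where the second-difference formula would divide by 0.\<close>

lemma pois_perturbation_le_kub_bound:
  obtains c :: real where "0 \<le> c"
    "\<And>h B l k. wnorm_le 1.95 h B \<Longrightarrow> 0 \<le> l \<Longrightarrow> (l = 0 \<Longrightarrow> B = 0) \<Longrightarrow>
      \<bar>fps_nth ((1 - fps_X)\<^sup>2 * h * pois_fps l) k\<bar> \<le> kub_bound c l B k"
proof -
  obtain K :: real where K: "0 < K" "\<And>j. 1.9 ^ j * (1 + (real j)\<^sup>2) \<le> K * 1.95 ^ j"
    using poly_power_le_power by blast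
  \<comment> \<open>\<open>16 * K\<close> serves the range \<open>k \<le> 1.9 l\<close>;
    \<open>2.9\<^sup>2\<close> is the norm bound of \<open>(1 - X)^2\<close> at weight 1.9 and
    serves the other.\<close>
  define c where "c = 16 * K + 2.9\<^sup>2"
  have "\<bar>fps_nth ((1 - fps_X)\<^sup>2 * h * pois_fps l) k\<bar> \<le> kub_bound c l B k"
    if h: "wnorm_le 1.95 h B" and l: "0 \<le> l" and l0: "l = 0 \<Longrightarrow> B = 0" for h B l k
  proof -
    have B0: "0 \<le> B" using h by (rule wnorm_le_nonneg)
    show ?thesis
    proof (cases "real k \<le> 1.9 * l")
      case False
      \<comment> \<open>At weight 1.9 the Poisson series has norm at most
        \<open>exp (0.9 l)\<close>, and reading off coefficient \<open>k\<close> divides by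
        \<open>1.9 ^ k\<close>: the shape of the second case.\<close>
      have "wnorm_le 1.9 h B" using h by (rule wnorm_le_weight_mono) auto
      then have "wnorm_le 1.9 ((1 - fps_X)\<^sup>2 * h * pois_fps l) ((1 + 1.9)\<^sup>2 * B * exp ((1.9 - 1) * l))"
        using l by (intro wnorm_le_mult wnorm_le_one_minus_X_squared wnorm_le_pois_fps) auto
      then have "\<bar>fps_nth ((1 - fps_X)\<^sup>2 * h * pois_fps l) k\<bar> * 1.9 ^ k
          \<le> (1 + 1.9)\<^sup>2 * B * exp ((1.9 - 1) * l)"
        by (rule wnorm_le_nth) simp
      also have "\<dots> \<le> c * B * exp (0.9 * l)"
        using K(1) B0 by (intro mult_mono) (auto simp: c_def)
      finally show ?thesis
        using False by (simp add: kub_bound_def pos_le_divide_eq)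
    next
      case True
      show ?thesis
      proof (cases "l = 0")
        case l_eq: True
        have "wnorm_le 1 h 0" using wnorm_le_weight_mono[OF h, of 1] l0 l_eq by simp
        then have "wnorm_le 1 ((1 - fps_X)\<^sup>2 * h * pois_fps l) ((1 + 1)\<^sup>2 * 0 * 1)"
          using l_eq by (intro wnorm_le_mult wnorm_le_one_minus_X_squared)
            (auto simp: pois_fps_0 wnorm_le_1)
        from wnorm_le_nth[OF this, of k] have "\<bar>fps_nth ((1 - fps_X)\<^sup>2 * h * pois_fps l) k\<bar> \<le> 0"
          by simp
        then show ?thesis using l_eq l0 by (simp add: kub_bound_def)
      next
        case False
        with l have l: "0 < l" by simp
        define R where "R = pois_prob l k * (1 / (real k + 1) + ((real k - l) / l)\<^sup>2)"
        have R0: "0 \<le> R" using l by (simp add: R_def pois_prob_def)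
        have "\<bar>fps_nth ((1 - fps_X)\<^sup>2 * h * pois_fps l) k\<bar>
            = \<bar>\<Sum>j=0..k. fps_nth h j * fps_nth ((1 - fps_X)\<^sup>2 * pois_fps l) (k - j)\<bar>"
          unfolding fps_mult_nth[symmetric] by (simp only: mult_ac)
        also have "\<dots> \<le> (\<Sum>j=0..k. \<bar>fps_nth h j * fps_nth ((1 - fps_X)\<^sup>2 * pois_fps l) (k - j)\<bar>)"
          by (rule sum_abs)
        \<comment> \<open>Trading \<open>1.9 ^ j * (1 + j\<^sup>2)\<close> for
          \<open>K * 1.95 ^ j\<close> leaves a partial sum of the weighted norm of
          \<open>h\<close>.\<close>
        also have "\<dots> \<le> (\<Sum>j=0..k. (16 * K * R) * (\<bar>fps_nth h j\<bar> * 1.95 ^ j))"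
        proof (rule sum_mono)
          fix j assume "j \<in> {0..k}"
          then have "\<bar>fps_nth ((1 - fps_X)\<^sup>2 * pois_fps l) (k - j)\<bar>
              \<le> 16 * (1.9 ^ j * (1 + (real j)\<^sup>2)) * R"
            unfolding R_def using l True by (intro pois_second_difference_le) auto
          also have "\<dots> \<le> 16 * (K * 1.95 ^ j) * R"
            using R0 K(2)[of j] by (intro mult_right_mono mult_left_mono) auto
          finally have "\<bar>fps_nth h j\<bar> * \<bar>fps_nth ((1 - fps_X)\<^sup>2 * pois_fps l) (k - j)\<bar>
              \<le> \<bar>fps_nth h j\<bar> * (16 * (K * 1.95 ^ j) * R)"
            by (intro mult_left_mono) auto
          then show "\<bar>fps_nth h j * fps_nth ((1 - fps_X)\<^sup>2 * pois_fps l) (k - j)\<bar>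
              \<le> (16 * K * R) * (\<bar>fps_nth h j\<bar> * 1.95 ^ j)"
            by (simp only: abs_mult mult_ac)
        qed
        also have "\<dots> = (16 * K * R) * (\<Sum>j<Suc k. \<bar>fps_nth h j\<bar> * 1.95 ^ j)"
          by (simp only: sum_distrib_left lessThan_Suc_atMost atMost_atLeast0)
        also have "\<dots> \<le> (16 * K * R) * B"
          using K(1) R0 by (intro mult_left_mono wnorm_leD[OF h]) auto
        also have "\<dots> \<le> (c * R) * B"
          using R0 B0 by (intro mult_right_mono) (auto simp: c_def)
        also have "\<dots> = kub_bound c l B k"
          using True by (simp add: kub_bound_def R_def pois_prob_def)
        finally show ?thesis .
      qed
    qed
  qed
  moreover have "0 \<le> c" using K(1) by (simp add: c_def)
  ultimately show thesis using that by blast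
qed

text \<open>\<open>kub_bound\<close> sees its constant and \<open>H2\<close> only through their
  product, so a factor can move from one to the other.\<close>

lemma kub_bound_mono:
  assumes "0 \<le> c" "0 \<le> l" "B \<le> C * B'"
  shows "kub_bound c l B k \<le> kub_bound (c * C) l B' k"
proof -
  have "c * B \<le> c * C * B'" using mult_left_mono[OF assms(3,1)] by (simp add: mult.assoc)
  then show ?thesis
    using assms(2) unfolding kub_bound_def by (auto intro!: mult_right_mono divide_right_mono)
qed

text \<open>Makes the final constant independent of \<open>T\<close>. The term at 0 is 0, since
  \<open>1 / 0 = 0\<close>.\<close>

lemma sum_inverse_squares_le:
  fixes T :: "nat set"
  assumes "finite T"
  shows "(\<Sum>p\<in>T. 1 / (real p)\<^sup>2) \<le> (\<Sum>n. 1 / (real n)\<^sup>2)"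
  using inverse_power_summable[of 2, where ?'a = real] assms
  by (intro sum_le_suminf) (auto simp: inverse_eq_divide)

theorem theorem4:
  shows "\<exists>C::real. \<forall>T::nat set. finite T \<and> (\<forall>p\<in>T. prime p) \<longrightarrow>
     (\<forall>k::nat.
        \<bar>pmf (U_law T) k - pois_prob (H T) k\<bar> \<le> kub_bound C (H T) (H'' T) k \<and>
        \<bar>pmf (W_law T) k - pois_prob (H' T) k\<bar> \<le> kub_bound C (H' T) (H'' T) k)"
proof -
  obtain c :: real where c: "0 \<le> c"
    "\<And>h B l k. wnorm_le 1.95 h B \<Longrightarrow> 0 \<le> l \<Longrightarrow> (l = 0 \<Longrightarrow> B = 0) \<Longrightarrow>
      \<bar>fps_nth ((1 - fps_X)\<^sup>2 * h * pois_fps l) k\<bar> \<le> kub_bound c l B k"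
    using pois_perturbation_le_kub_bound by blast
  \<comment> \<open>Above 1.9 to absorb polynomial factors, below 2 to keep the geometric factor at
    \<open>p = 2\<close> summable.\<close>
  define r :: real where "r = 1.95"
  have r: "1 < r" "r < 2" by (simp_all add: r_def)
  define K where "K = 3 * exp r / (r - 1)\<^sup>2"
  \<comment> \<open>The U and W constants added up, so that one \<open>d\<close> serves both; the 4
    comes from \<open>1 / (p - 1) \<le> 2 / p\<close>.\<close>
  define d where "d = 1 + (2 + r) * K + 4 * (1 / (1 - r / 2) * K)"
  \<comment> \<open>From \<open>S exp ((1 + r)\<^sup>2 S)\<close> with \<open>S = d * H'' T\<close>:
    the linear \<open>S\<close> is kept, and only the one in the exponent is replaced by the full
    series.\<close>
  define C where "C = d * exp ((1 + r)\<^sup>2 * (d * (\<Sum>n. 1 / (real n)\<^sup>2)))"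
  have K0: "0 \<le> K" by (simp add: K_def)
  have d0: "0 \<le> d" using K0 r by (simp add: d_def)
  \<comment> \<open>Treats both laws at once: \<open>G p\<close> is the local generating function
    and \<open>a p\<close> its Poisson parameter.\<close>
  have key: "\<bar>pmf Y k - pois_prob (sum a T) k\<bar> \<le> kub_bound (c * C) (sum a T) (H'' T) k"
    if T: "finite T" and Y: "Abs_fps (pmf Y) = (\<Prod>p\<in>T. G p)" and a: "\<And>p. p \<in> T \<Longrightarrow> 0 < a p"
      and G: "\<And>p. p \<in> T \<Longrightarrow> \<exists>u. G p * pois_fps (- a p) = 1 + (1 - fps_X)\<^sup>2 * u \<and>
        wnorm_le r u (d * (1 / (real p)\<^sup>2))"
    for T :: "nat set" and Y :: "nat pmf" and G a k
  proof -
    define S where "S = (\<Sum>p\<in>T. d * (1 / (real p)\<^sup>2))"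
    define B where "B = S * exp ((1 + r)\<^sup>2 * S)"
    have S: "S = d * H'' T" by (simp add: S_def H''_def sum_distrib_left)
    obtain h where h: "(\<Prod>p\<in>T. G p) = pois_fps (sum a T) + (1 - fps_X)\<^sup>2 * h * pois_fps (sum a T)"
      "wnorm_le r h B"
      using prod_eq_pois_fps_perturbation[OF T _ G] r(1) unfolding B_def S_def by force
    have a0: "0 \<le> sum a T" using a by (intro sum_nonneg) (simp add: less_imp_le)
    have "pmf Y k = fps_nth (Abs_fps (pmf Y)) k" by simp
    then have "pmf Y k - pois_prob (sum a T) k = fps_nth ((1 - fps_X)\<^sup>2 * h * pois_fps (sum a T)) k"
      unfolding Y h(1) by (simp add: pois_fps_nth)
    \<comment> \<open>Positive parameters with sum 0 leave only \<open>T = {}\<close>, which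
      supplies the condition at \<open>l = 0\<close>.\<close>
    moreover have "B = 0" if "sum a T = 0"
    proof -
      have "T = {}" using sum_pos[of T a] a T that by force
      then show ?thesis by (simp add: B_def S_def)
    qed
    ultimately have "\<bar>pmf Y k - pois_prob (sum a T) k\<bar> \<le> kub_bound c (sum a T) B k"
      using c(2)[OF h(2)[unfolded r_def] a0] by simp
    also have "\<dots> \<le> kub_bound (c * C) (sum a T) (H'' T) k"
    proof (rule kub_bound_mono[OF c(1) a0])
      have "S \<le> d * (\<Sum>n. 1 / (real n)\<^sup>2)"
        unfolding S H''_def using sum_inverse_squares_le[OF T] d0 by (rule mult_left_mono)
      then have "B \<le> S * exp ((1 + r)\<^sup>2 * (d * (\<Sum>n. 1 / (real n)\<^sup>2)))"
        unfolding B_def using d0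
        by (intro mult_left_mono) (auto simp: S_def sum_nonneg intro!: mult_left_mono)
      then show "B \<le> C * H'' T" by (simp add: C_def S mult_ac)
    qed
    finally show ?thesis .
  qed
  show ?thesis
  proof (intro exI[of _ "c * C"] allI impI conjI)
    fix T :: "nat set" and k :: nat
    assume T: "finite T \<and> (\<forall>p\<in>T. prime p)"
    then have p2: "2 \<le> p" if "p \<in> T" for p using that prime_ge_2_nat by blast
    show "\<bar>pmf (U_law T) k - pois_prob (H T) k\<bar> \<le> kub_bound (c * C) (H T) (H'' T) k"
      unfolding H_def
    proof (rule key)
      fix p assume "p \<in> T"
      with p2 have p: "2 \<le> p" by blast
      then show "0 < 1 / real p" by simp
      have "(1 + (2 + r) * K) * (1 / real p)\<^sup>2 \<le> d * (1 / (real p)\<^sup>2)"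
        unfolding power_divide power_one
        using K0 r by (intro mult_right_mono) (auto simp: d_def)
      then show "\<exists>u. (1 + fps_const (1 / real p) * (fps_X - 1)) * pois_fps (- (1 / real p))
          = 1 + (1 - fps_X)\<^sup>2 * u \<and> wnorm_le r u (d * (1 / (real p)\<^sup>2))"
        using U_factor_second_order[of "1 / real p" r, folded K_def] p r(1)
        by (auto intro: wnorm_le_mono)
    qed (use T p2 in \<open>auto intro: U_law_pgf\<close>)
    show "\<bar>pmf (W_law T) k - pois_prob (H' T) k\<bar> \<le> kub_bound (c * C) (H' T) (H'' T) k"
      unfolding H'_def
    proof (rule key)
      fix p assume "p \<in> T"
      with p2 have p: "2 \<le> p" by blast
      then show "0 < 1 / (real p - 1)" by simp
      have "(1 / (real p - 1))\<^sup>2 \<le> (2 / real p)\<^sup>2"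
        using p by (intro power_mono) (auto simp: field_simps)
      then have "1 / (1 - r / 2) * K * (1 / (real p - 1))\<^sup>2 \<le> 1 / (1 - r / 2) * K * (4 * (1 / (real p)\<^sup>2))"
        using K0 r by (intro mult_left_mono) (auto simp: power_divide)
      also have "\<dots> = 4 * (1 / (1 - r / 2) * K) * (1 / (real p)\<^sup>2)" by simp
      also have "\<dots> \<le> d * (1 / (real p)\<^sup>2)"
        using K0 r by (intro mult_right_mono) (auto simp: d_def)
      finally show "\<exists>u. Abs_fps (\<lambda>n. (1 - 1 / real p) * (1 / real p) ^ n) * pois_fps (- (1 / (real p - 1)))
          = 1 + (1 - fps_X)\<^sup>2 * u \<and> wnorm_le r u (d * (1 / (real p)\<^sup>2))"
        using W_factor_second_order[OF p r, folded K_def] by (auto intro: wnorm_le_mono)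
    qed (use T p2 in \<open>auto intro: W_law_pgf\<close>)
  qed
qed

end
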